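(* Let $H$ be an $n\times n$ matrix with entries in $\{+1,-1\}$ and let $G$ be its $n$-full oriented hypergraph. For every edge-monic tail-equivalence class $\mathcal{A}$ of contributors of $G$, \[ \Bigl|\sum_{c\in\mathcal{A}}(-1)^{pc(c)}\Bigr|=|\det(H)|. \]
   Context: Let $H=(h_{ij})$ be an $n\times n$ $\{\pm1\}$-matrix. Its $n$-full oriented hypergraph $G$ has vertices $v_1,\dots,v_n$, edges $e_1,\dots,e_n$, and exactly one incidence $(v_i,e_j)$ for every pair $i,j$, with orientation $\sigma(v_i,e_j)=h_{ij}$. A step is a triple $(v,e,w)$ (tail vertex $v$, edge $e$, head vertex $w$), with sign $-\sigma(v,e)\sigma(w,e)$; it is a backstep if $w=v$ (sign $-1$). A contributor $c$ consists of one step $(v,f(v),\pi(v))$ for each vertex $v$, where $f:V\to E$ is any function and $\pi:V\to V$ is a bijection. The components of $c$ are the cycles of $\pi$; the sign of a component is the product of the signs of its steps, and $pc(c)$ is the number of components of sign $+1$. A tail-equivalence class is the set of all contributors with a fixed $f$; it is edge-monic if $f$ is injective. *)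

theory Defs
  imports "HOL-Analysis.Analysis" "HOL-Combinatorics.Orbits"
begin

text \<open>
  Oriented hypergraphs without multiple incidences: an incidence is identified with its
  vertex-edge pair. The value of \<open>orientation\<close> matters only on \<open>incidences\<close>.
\<close>

record ('v, 'e) oriented_hypergraph =
  verts :: "'v set"
  edges :: "'e set"
  incidences :: "('v \<times> 'e) set"
  orientation :: "'v \<times> 'e \<Rightarrow> int"

definition pm_one_matrix :: "int^'n^'n \<Rightarrow> bool"
  where "pm_one_matrix H \<longleftrightarrow> (\<forall>i j. H $ i $ j \<in> {1, -1})"

text \<open>
  The index type \<open>'n\<close> names both the vertices \<open>v\<^sub>i\<close> (rows) and the edges \<open>e\<^sub>j\<close> (columns).
\<close>

definition full_hypergraph :: "int^'n^'n \<Rightarrow> ('n, 'n) oriented_hypergraph"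
  where "full_hypergraph H =
    \<lparr>verts = UNIV, edges = UNIV, incidences = UNIV \<times> UNIV, orientation = (\<lambda>(i, j). H $ i $ j)\<rparr>"

type_synonym ('v, 'e) step = "'v \<times> 'e \<times> 'v"

definition steps :: "('v, 'e) oriented_hypergraph \<Rightarrow> ('v, 'e) step set"
  where "steps G = {(v, e, w). (v, e) \<in> incidences G \<and> (w, e) \<in> incidences G}"

fun step_sign :: "('v, 'e) oriented_hypergraph \<Rightarrow> ('v, 'e) step \<Rightarrow> int"
  where "step_sign G (v, e, w) = - orientation G (v, e) * orientation G (w, e)"

text \<open>
  A contributor is the pair \<open>(f, \<pi>)\<close>, standing for the family of steps \<open>(v, f v, \<pi> v)\<close>.
  Outside the vertex set, \<open>f\<close> is \<open>undefined\<close> (by \<open>\<rightarrow>\<^sub>E\<close>) and \<open>\<pi>\<close> is the identity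
  (by \<open>permutes\<close>), so that distinct pairs are distinct contributors.
\<close>

type_synonym ('v, 'e) contributor = "('v \<Rightarrow> 'e) \<times> ('v \<Rightarrow> 'v)"

definition contributor_step :: "('v, 'e) contributor \<Rightarrow> 'v \<Rightarrow> ('v, 'e) step"
  where "contributor_step c v = (v, fst c v, snd c v)"

definition contributors :: "('v, 'e) oriented_hypergraph \<Rightarrow> ('v, 'e) contributor set"
  where "contributors G = {c. fst c \<in> verts G \<rightarrow>\<^sub>E edges G \<and> snd c permutes verts G \<and>
    (\<forall>v\<in>verts G. contributor_step c v \<in> steps G)}"

definition contributor_components ::
    "('v, 'e) oriented_hypergraph \<Rightarrow> ('v, 'e) contributor \<Rightarrow> ('v, 'e) step set set"
  where "contributor_components G c = (\<lambda>v. contributor_step c ` orbit (snd c) v) ` verts G"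

definition component_sign :: "('v, 'e) oriented_hypergraph \<Rightarrow> ('v, 'e) step set \<Rightarrow> int"
  where "component_sign G C = (\<Prod>s\<in>C. step_sign G s)"

definition pc :: "('v, 'e) oriented_hypergraph \<Rightarrow> ('v, 'e) contributor \<Rightarrow> nat"
  where "pc G c = card {C \<in> contributor_components G c. component_sign G C = 1}"

definition tail_equiv ::
    "('v, 'e) oriented_hypergraph \<Rightarrow> (('v, 'e) contributor \<times> ('v, 'e) contributor) set"
  where "tail_equiv G = {(c, d) \<in> contributors G \<times> contributors G. fst c = fst d}"

definition tail_classes :: "('v, 'e) oriented_hypergraph \<Rightarrow> ('v, 'e) contributor set set"
  where "tail_classes G = contributors G // tail_equiv G"

definition edge_monic :: "('v, 'e) oriented_hypergraph \<Rightarrow> ('v, 'e) contributor set \<Rightarrow> bool"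
  where "edge_monic G A \<longleftrightarrow> (\<forall>c\<in>A. inj_on (fst c) (verts G))"

end

theory Submission
  imports Defs "HOL-Combinatorics.Cycles"
begin

text \<open>
  Every component has sign \<open>\<plusminus>1\<close>, so \<open>(-1) ^ pc\<close> is the product over the components of their
  negated signs. The negations contribute \<open>(-1)\<close> to the power of the number of cycles, i.e. \<open>sign \<pi>\<close> up
  to the factor \<open>(-1) ^ n\<close>, and the remaining product runs over all steps. For fixed bijective
  \<open>f\<close> the class sum is therefore, up to sign, the Leibniz expansion of the determinant of
  \<open>H\<close> with its columns permuted by \<open>f\<close>.
\<close>

text \<open>Powers of the cycle act on the list by rotation, so the orbit of the head meets every
  entry.\<close>

lemma cyclic_on_cycle_of_list:
  assumes "distinct cs" "cs \<noteq> []"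
  shows "cyclic_on (cycle_of_list cs) (set cs)"
proof -
  let ?p = "cycle_of_list cs"
  have nth: "(?p ^^ n) (hd cs) = cs ! (n mod length cs)" for n
  proof -
    have "(?p ^^ n) (hd cs) = hd (map (?p ^^ n) cs)"
      using assms(2) by (simp add: hd_map)
    also have "\<dots> = hd (rotate n cs)"
      by (simp only: cyclic_rotation[OF assms(1)])
    also have "\<dots> = cs ! (n mod length cs)"
      using assms(2) by (rule hd_rotate_conv_nth)
    finally show ?thesis .
  qed
  have "orbit ?p (hd cs) = {(?p ^^ n) (hd cs) | n. True}"
    by (rule orbit_altdef_permutation[OF permutation_of_cycle])
  also have "\<dots> = set cs"
  proof safe
    fix n show "(?p ^^ n) (hd cs) \<in> set cs"
      using assms(2) by (simp add: nth)
  next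
    fix x assume "x \<in> set cs"
    then obtain i where "i < length cs" "x = cs ! i"
      by (auto simp: in_set_conv_nth)
    then have "x = (?p ^^ i) (hd cs)"
      by (simp add: nth)
    then show "\<exists>n. x = (?p ^^ n) (hd cs) \<and> True"
      by blast
  qed
  finally show ?thesis
    using assms(2) by (intro cyclic_on_singleI[of "hd cs"]) auto
qed

text \<open>A cycle of length k is a product of k - 1 transpositions. The form
  \<open>- ((-1) ^ length cs)\<close> avoids the subtraction, and it would be wrong for the empty
  list, whose cycle is the identity.\<close>

lemma sign_cycle_of_list:
  assumes "distinct cs" "cs \<noteq> []"
  shows "sign (cycle_of_list cs) = - ((-1) ^ length cs)"
  using assms
proof (induction cs rule: cycle_of_list.induct)
  case (1 i j cs)
  then have "sign (cycle_of_list (j # cs)) = - ((-1) ^ length (j # cs))" "i \<noteq> j"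
    by auto
  moreover have "sign (cycle_of_list (i # j # cs)) =
      sign (Transposition.transpose i j) * sign (cycle_of_list (j # cs))"
    by (simp only: cycle_of_list.simps sign_compose permutation_swap_id permutation_of_cycle)
  ultimately show ?case
    by (simp only: sign_swap_id) simp
qed auto

lemma cycle_decomp_permutes: "cycle_decomp S p \<Longrightarrow> finite S \<and> p permutes S"
proof (induction rule: cycle_decomp.induct)
  case (comp I p cs)
  have "cycle_of_list cs permutes set cs \<union> I"
    using cycle_permutes by (rule permutes_subset) blast
  moreover have "p permutes set cs \<union> I"
    using comp.IH by (auto intro: permutes_subset)
  ultimately have "cycle_of_list cs \<circ> p permutes set cs \<union> I"
    by (intro permutes_compose)
  then show ?case
    using comp.IH by blast
qed (simp add: id_def)

text \<open>In a decomposition into disjoint cycles, each nonempty cycle adds its length to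
  \<open>card S\<close> and one to the number of orbits, which matches its own sign. Fixed points
  count as orbits of size one.\<close>

lemma sign_eq_card_orbits:
  assumes "p permutes S" "finite S"
  shows "sign p = (-1) ^ card S * (-1) ^ card (orbit p ` S)"
proof -
  have "cycle_decomp S p"
    using assms by (rule cycle_decomposition)
  then show ?thesis
  proof (induction rule: cycle_decomp.induct)
    case empty
    then show ?case by simp
  next
    case (comp I p cs)
    show ?case
    \<comment> \<open>A decomposition may contain empty cycles; these add no orbit.\<close>
    proof (cases "cs = []")
      case True
      then show ?thesis using comp.IH by (simp add: id_def)
    next
      case False
      let ?c = "cycle_of_list cs"
      have I: "finite I" "p permutes I"
        using cycle_decomp_permutes[OF comp.hyps(1)] by auto
      \<comment> \<open>The supports are disjoint: \<open>p\<close> fixes \<open>set cs\<close>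
        pointwise, and below \<open>?c\<close> fixes \<open>I\<close> pointwise.\<close>
      have "cyclic_on (?c \<circ> p) (set cs)"
        using cyclic_on_cycle_of_list[OF comp.hyps(2) False] I(2) comp.hyps(3)
        by (intro permutes_comp_preserves_cyclic1[where A = "set cs"]) auto
      then have orb_cs: "orbit (?c \<circ> p) x = set cs" if "x \<in> set cs" for x
        using that by (rule orbit_cyclic_eq3)
      have orb_I: "orbit (?c \<circ> p) x = orbit p x" if "x \<in> I" for x
      proof (rule orbit_cyclic_eq3)
        show "cyclic_on (?c \<circ> p) (orbit p x)"
          using cycle_permutes cyclic_on_orbit[OF I(2,1)] comp.hyps(3)
            permutes_orbit_subset[OF I(2) that]
          by (rule permutes_comp_preserves_cyclic2)
        show "x \<in> orbit p x"
          using I by (intro permutation_self_in_orbit) (auto simp: permutation_permutes)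
      qed
      have "orbit (?c \<circ> p) ` (set cs \<union> I) = insert (set cs) (orbit p ` I)"
        using orb_cs orb_I False by (auto simp: image_Un image_iff)
      \<comment> \<open>Orbits of \<open>p\<close> in \<open>I\<close> stay inside \<open>I\<close>,
        which is disjoint from the nonempty \<open>set cs\<close>; hence exactly one orbit is
        new.\<close>
      moreover have "set cs \<notin> orbit p ` I"
        using permutes_orbit_subset[OF I(2)] comp.hyps(3) False
        by (metis Int_absorb2 image_iff set_empty)
      ultimately have "card (orbit (?c \<circ> p) ` (set cs \<union> I)) = Suc (card (orbit p ` I))"
        using I(1) by simp
      moreover have "card (set cs \<union> I) = length cs + card I"
        using I(1) comp.hyps by (simp add: card_Un_disjoint distinct_card)
      moreover have "permutation p"
        using I by (auto simp: permutation_permutes)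
      then have "sign (?c \<circ> p) = - ((-1) ^ length cs) * sign p"
        by (simp add: sign_compose permutation_of_cycle sign_cycle_of_list comp.hyps(2) False)
      ultimately show ?thesis
        by (simp only: comp.IH) (simp add: power_add)
    qed
  qed
qed

lemma prod_orbits:
  assumes "p permutes S" "finite S"
  shows "(\<Prod>C\<in>orbit p ` S. \<Prod>x\<in>C. g x) = (\<Prod>x\<in>S. g x)"
proof -
  have perm: "permutation p"
    using assms by (auto simp: permutation_permutes)
  have "\<forall>A\<in>orbit p ` S. \<forall>B\<in>orbit p ` S. A \<noteq> B \<longrightarrow> A \<inter> B = {}"
    using orbit_cyclic_eq3[OF cyclic_on_orbit[OF assms]] by blast
  moreover have "\<forall>A\<in>orbit p ` S. finite A"
    using perm by (auto intro: finite_orbit permutation_self_in_orbit)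
  ultimately have "prod g (\<Union>(orbit p ` S)) = (prod \<circ> prod) g (orbit p ` S)"
    by (intro prod.Union_disjoint)
  \<comment> \<open>\<open>orbit p x\<close> is generated from \<open>p x\<close>; it contains
    \<open>x\<close> because some positive power of a finite permutation returns to
    \<open>x\<close>.\<close>
  moreover have "\<Union>(orbit p ` S) = S"
    using permutes_orbit_subset[OF assms(1)] permutation_self_in_orbit[OF perm] by blast
  ultimately show ?thesis by simp
qed

text \<open>After negation, a value 1 contributes the factor -1 and a value -1 contributes the
  factor 1.\<close>

lemma minus_one_power_card_eq_one:
  fixes s :: "'a \<Rightarrow> int"
  assumes "finite K" "\<And>C. C \<in> K \<Longrightarrow> s C \<in> {1, -1}"
  shows "(-1) ^ card {C \<in> K. s C = 1} = (\<Prod>C\<in>K. - s C)"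
proof -
  have "(\<Prod>C\<in>K. - s C) = (\<Prod>C\<in>K. if s C = 1 then -1 else 1)"
    using assms(2) by (intro prod.cong) auto
  also have "\<dots> = (\<Prod>C\<in>{C \<in> K. s C = 1}. -1)"
    using assms(1) by (rule prod.inter_filter[symmetric])
  finally show ?thesis by simp
qed

lemma prod_in_plus_minus_one:
  fixes g :: "'a \<Rightarrow> int"
  assumes "\<And>x. x \<in> A \<Longrightarrow> g x \<in> {1, -1}"
  shows "(\<Prod>x\<in>A. g x) \<in> {1, -1}"
proof -
  have "\<bar>\<Prod>x\<in>A. g x\<bar> = (\<Prod>x\<in>A. 1)"
    unfolding abs_prod using assms by (intro prod.cong) force+
  then have "\<bar>\<Prod>x\<in>A. g x\<bar> = 1"
    by (simp only: prod.neutral_const)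
  then show ?thesis
    by (simp only: abs_eq_iff' insert_iff empty_iff) simp
qed

text \<open>The first product is independent of \<open>p\<close>; the rest is a Leibniz term with
  \<open>p\<close> acting on the rows.\<close>

lemma minus_one_power_pc:
  fixes H :: "int^'n^'n"
  assumes H: "pm_one_matrix H" and p: "p permutes UNIV"
  shows "(-1) ^ pc (full_hypergraph H) (f, p) =
    (\<Prod>v\<in>UNIV. H $ v $ f v) * (sign p * (\<Prod>v\<in>UNIV. H $ p v $ f v))"
proof -
  let ?G = "full_hypergraph H"
  define st where "st = contributor_step (f, p)"
  define s where "s v = step_sign ?G (st v)" for v
  have s: "s v = - (H $ v $ f v * H $ p v $ f v)" for v
    by (simp add: s_def st_def contributor_step_def full_hypergraph_def)
  have entry: "H $ i $ j \<in> {1, -1}" for i j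
    using H by (simp add: pm_one_matrix_def)
  have s_pm: "s v \<in> {1, -1}" for v
    using entry[of v "f v"] entry[of "p v" "f v"] by (auto simp: s)
  \<comment> \<open>A step records its tail, so distinct orbits give distinct components and
    products over components become products over orbits.\<close>
  have inj: "inj st"
    by (auto simp: inj_def st_def contributor_step_def)
  have comps: "contributor_components ?G (f, p) = image st ` range (orbit p)"
    by (auto simp: contributor_components_def st_def full_hypergraph_def)
  have comp_sign: "component_sign ?G (st ` C) = (\<Prod>v\<in>C. s v)" for C
    by (simp add: component_sign_def s_def prod.reindex inj_on_subset[OF inj])
  have "(-1) ^ pc ?G (f, p) = (\<Prod>C\<in>image st ` range (orbit p). - component_sign ?G C)"
    unfolding pc_def comps
  proof (rule minus_one_power_card_eq_one)
    fix K assume "K \<in> image st ` range (orbit p)"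
    then obtain C where "K = st ` C" by blast
    then show "component_sign ?G K \<in> {1, -1}"
      using prod_in_plus_minus_one[of C s] s_pm by (simp add: comp_sign)
  qed simp
  also have "\<dots> = (\<Prod>C\<in>range (orbit p). - (\<Prod>v\<in>C. s v))"
    by (subst prod.reindex)
       (auto simp: comp_sign inj_on_def inj_image_eq_iff[OF inj])
  also have "\<dots> = (-1) ^ card (range (orbit p)) * (\<Prod>C\<in>range (orbit p). \<Prod>v\<in>C. s v)"
    by (simp only: prod_uminus)
  also have "(\<Prod>C\<in>range (orbit p). \<Prod>v\<in>C. s v) = (\<Prod>v\<in>UNIV. s v)"
    using p by (intro prod_orbits) auto
  also have "\<dots> = (-1) ^ CARD('n) * ((\<Prod>v\<in>UNIV. H $ v $ f v) * (\<Prod>v\<in>UNIV. H $ p v $ f v))"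
    by (simp only: s prod_uminus prod.distrib)
  \<comment> \<open>The component negations give -1 to the number of orbits, the step signs give -1
    to the number of vertices; together these are \<open>sign p\<close>.\<close>
  finally show ?thesis
    using sign_eq_card_orbits[OF p] by (simp add: ac_simps)
qed

text \<open>With all incidences present, every function paired with every permutation is a
  contributor, so fixing the tails leaves \<open>p\<close> free.\<close>

lemma full_hypergraph_tail_class:
  fixes H :: "int^'n^'n"
  assumes "A \<in> tail_classes (full_hypergraph H)"
  obtains f where "A = Pair f ` {p. p permutes UNIV}"
proof -
  have contr: "contributors (full_hypergraph H) = UNIV \<times> {p. p permutes UNIV}"
    by (auto simp: contributors_def full_hypergraph_def contributor_step_def steps_def)
  from assms obtain c where "c \<in> contributors (full_hypergraph H)"
    "A = tail_equiv (full_hypergraph H) `` {c}"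
    unfolding tail_classes_def by (rule quotientE)
  then have "A = Pair (fst c) ` {p. p permutes UNIV}"
    by (auto simp: tail_equiv_def contr)
  then show thesis by (rule that)
qed

theorem theorem5:
  fixes H :: "int^'n^'n" and A :: "('n, 'n) contributor set"
  assumes "pm_one_matrix H"
    and "A \<in> tail_classes (full_hypergraph H)"
    and "edge_monic (full_hypergraph H) A"
  shows "\<bar>\<Sum>c\<in>A. (-1) ^ pc (full_hypergraph H) c\<bar> = \<bar>det H\<bar>"
proof -
  obtain f where A: "A = Pair f ` {p. p permutes UNIV}"
    using full_hypergraph_tail_class[OF assms(2)] .
  \<comment> \<open>The contributor consisting of backsteps only shows that the class is nonempty,
    so edge-monicity really constrains \<open>f\<close>.\<close>
  have "(f, id) \<in> A"
    unfolding A by (intro imageI CollectI permutes_id)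
  then have "inj f"
    using assms(3) by (auto simp: edge_monic_def full_hypergraph_def)
  \<comment> \<open>Vertices and edges share one finite index type, so the injective
    \<open>f\<close> is a permutation of the columns.\<close>
  then have f: "f permutes UNIV"
    by (intro bij_imp_permutes) (auto simp: bij_def finite_UNIV_inj_surj)
  let ?B = "\<chi> i j. H $ i $ f j"
  let ?d = "\<Prod>v\<in>UNIV. H $ v $ f v"
  have "(\<Sum>c\<in>A. (-1) ^ pc (full_hypergraph H) c) =
      (\<Sum>p | p permutes UNIV. (-1) ^ pc (full_hypergraph H) (f, p))"
    unfolding A by (simp add: sum.reindex inj_on_def)
  also have "\<dots> = (\<Sum>p | p permutes UNIV. ?d * (sign p * (\<Prod>v\<in>UNIV. H $ p v $ f v)))"
    by (intro sum.cong) (auto simp: minus_one_power_pc[OF assms(1)])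
  \<comment> \<open>The transpose appears because \<open>det_def\<close> lets the permutation act on
    the column index.\<close>
  also have "\<dots> = ?d * det (transpose ?B)"
    by (simp add: det_def transpose_def sum_distrib_left)
  also have "\<dots> = ?d * (sign f * det H)"
    using det_permute_columns[OF f, of H] by simp
  finally have "\<bar>\<Sum>c\<in>A. (-1) ^ pc (full_hypergraph H) c\<bar> = \<bar>?d\<bar> * \<bar>det H\<bar>"
    by (simp add: abs_mult)
  moreover have "?d \<in> {1, -1}"
    using assms(1) by (intro prod_in_plus_minus_one) (simp add: pm_one_matrix_def)
  ultimately show ?thesis by auto
qed

end
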